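(* Let $n,k$ be positive integers. If there exists a Breaker pairing strategy for $\mathcal{Q}(n,k)$, then there exists a Breaker pairing strategy for $\mathcal{Q}(4n,b)$, where $b=\max\{4k-3,\,n+k\}$.
   Context: $Q_n$ is the hypercube graph on $\{0,1\}^n$ (vertices adjacent iff they differ in exactly one coordinate). A $k$-dimensional subcube of $Q_n$ is obtained by choosing $n-k$ coordinates and fixed values in $\{0,1\}$ for them, and taking all $2^k$ vectors agreeing with these fixed values. $\mathcal{Q}(n,k)$ is the hypergraph with vertex set $\{0,1\}^n$ whose edges are the $k$-dimensional subcubes of $Q_n$; Maker and Breaker alternately claim vertices, Maker winning iff she claims all vertices of some $k$-dimensional subcube. Following the paper's convention, a Breaker pairing strategy for $\mathcal{Q}(n,k)$ is a matching $M$ in $Q_n$ (set of pairwise disjoint edges) such that every $k$-dimensional subcube of $Q_n$ contains both endpoints of at least one edge of $M$. *)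

theory Defs
  imports Main
begin

text \<open>Vectors in $\{0,1\}^n$ are Boolean lists of length \<open>n\<close>; coordinates are numbered from \<open>0\<close>.\<close>

definition cube_verts :: "nat \<Rightarrow> bool list set" where
  "cube_verts n = {x. length x = n}"

definition cube_edges :: "nat \<Rightarrow> bool list set set" where
  "cube_edges n = {{x, y} |x y. x \<in> cube_verts n \<and> y \<in> cube_verts n \<and> card {i. i < n \<and> x ! i \<noteq> y ! i} = 1}"

text \<open>The number of fixed coordinates is given by \<open>card F + k = n\<close> rather than by truncated
  subtraction, so that there are no \<open>k\<close>-dimensional subcubes when \<open>k > n\<close>. Only the values of \<open>c\<close>
  on \<open>F\<close> matter.\<close>

definition subcubes :: "nat \<Rightarrow> nat \<Rightarrow> bool list set set" where
  "subcubes n k =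
     {{x \<in> cube_verts n. \<forall>i\<in>F. x ! i = c i} |F (c :: nat \<Rightarrow> bool). F \<subseteq> {..<n} \<and> card F + k = n}"

definition cube_matching :: "nat \<Rightarrow> bool list set set \<Rightarrow> bool" where
  "cube_matching n M \<longleftrightarrow> M \<subseteq> cube_edges n \<and> pairwise disjnt M"

definition breaker_pairing_strategy :: "nat \<Rightarrow> nat \<Rightarrow> bool list set set \<Rightarrow> bool" where
  "breaker_pairing_strategy n k M \<longleftrightarrow>
     cube_matching n M \<and> (\<forall>S\<in>subcubes n k. \<exists>e\<in>M. e \<subseteq> S)"

end

theory Submission
  imports Defs
begin

text \<open>
  Arrange the \<open>4n\<close> coordinates in a grid with four rows and \<open>n\<close> columns, and send a point of
  \<open>Q\<^bsub>4n\<^esub>\<close> to its column parities \<open>v\<close> in \<open>Q\<^sub>n\<close> and its row parities \<open>z\<close> in \<open>Q\<^sub>4\<close>. Besides the given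
  pairing \<open>M\<close> of \<open>Q\<^sub>n\<close> use a perfect matching of \<open>Q\<^sub>4\<close> that meets every 2-dimensional subcube in an
  edge and every 3-dimensional subcube in an edge of each of its three directions. Flipping the
  cell \<open>(r, j)\<close> moves \<open>v\<close> in direction \<open>j\<close> and \<open>z\<close> in direction \<open>r\<close>, so we may pair a point by
  flipping \<open>(r, j)\<close>, where \<open>r\<close> is the matching direction at \<open>z\<close> and \<open>j\<close> that of \<open>M\<close> at \<open>v\<close>.

  Given a subcube with \<open>b\<close> free cells, \<open>b \<ge> 4k - 3\<close> provides a row with \<open>k\<close> free cells, and
  \<open>b \<ge> n + k\<close> provides two rows with a free cell, each with \<open>k\<close> of them if there are only two. Hence
  the row parities can be steered to a point whose matching direction \<open>r\<close> is a row with \<open>k\<close> free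
  cells; moving inside row \<open>r\<close> keeps that direction and lets \<open>v\<close> range over a \<open>k\<close>-dimensional
  subcube, which contains an edge of \<open>M\<close>.
\<close>

section \<open>Cube edges as coordinate flips\<close>

definition flip :: "nat \<Rightarrow> bool list \<Rightarrow> bool list" where
  "flip i x = x[i := \<not> x ! i]"

lemma length_flip [simp]: "length (flip i x) = length x"
  by (simp add: flip_def)

lemma nth_flip: "i < length x \<Longrightarrow> flip i x ! l = (if l = i then \<not> x ! l else x ! l)"
  by (simp add: flip_def nth_list_update)

lemma flip_flip [simp]: "flip i (flip i x) = x"
  by (cases "i < length x") (auto simp: flip_def list_update_beyond)

lemma flip_eq_iff:
  assumes "i < length x" "j < length x"
  shows "flip i x = flip j x \<longleftrightarrow> i = j"
  using assms by (metis nth_flip)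

lemma cube_edges_flip:
  "cube_edges n = {{x, flip i x} |x i. length x = n \<and> i < n}"
proof (intro equalityI subsetI)
  fix e assume "e \<in> cube_edges n"
  then obtain x y where e: "e = {x, y}" and len: "length x = n" "length y = n"
    and one: "card {i. i < n \<and> x ! i \<noteq> y ! i} = 1"
    by (auto simp: cube_edges_def cube_verts_def)
  from one obtain i where "{i. i < n \<and> x ! i \<noteq> y ! i} = {i}"
    by (rule card_1_singletonE)
  then have i: "l < n \<and> x ! l \<noteq> y ! l \<longleftrightarrow> l = i" for l
    by (simp add: set_eq_iff)
  have "i < n" using i[of i] by simp
  moreover have "y = flip i x"
  proof (rule nth_equalityI)
    fix l assume "l < length y"
    then show "y ! l = flip i x ! l" using len i[of l] \<open>i < n\<close> by (auto simp: nth_flip)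
  qed (simp add: len)
  ultimately show "e \<in> {{x, flip i x} |x i. length x = n \<and> i < n}"
    using e len by blast
next
  fix e assume "e \<in> {{x, flip i x} |x i. length x = n \<and> i < n}"
  then obtain x i where e: "e = {x, flip i x}" and x: "length x = n" "i < n" by blast
  have "{l. l < n \<and> x ! l \<noteq> flip i x ! l} = {i}"
    using x by (auto simp: nth_flip)
  then show "e \<in> cube_edges n"
    unfolding cube_edges_def cube_verts_def mem_Collect_eq using e x
    by (intro exI[of _ x] exI[of _ "flip i x"]) simp
qed

text \<open>Toggling \<open>P\<close> at \<open>a\<close> adds or removes exactly one element. This
  is why flipping one cell toggles its row or column parity.\<close>

lemma odd_card_flip:
  fixes P :: "nat \<Rightarrow> bool"
  assumes "a < n"
  shows "odd (card {j. j < n \<and> (if j = a then \<not> P j else P j)}) \<longleftrightarrow> even (card {j. j < n \<and> P j})"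
proof -
  let ?A = "{j. j < n \<and> P j \<and> j \<noteq> a}"
  have "finite ?A" "a \<notin> ?A" by auto
  then have "card (insert a ?A) = Suc (card ?A)" by simp
  moreover have "{j. j < n \<and> (if j = a then \<not> P j else P j)} = (if P a then ?A else insert a ?A)"
    using assms by auto
  moreover have "{j. j < n \<and> P j} = (if P a then insert a ?A else ?A)"
    using assms by auto
  ultimately show ?thesis by simp
qed

section \<open>A perfect matching of the 4-cube\<close>

text \<open>The edges in each direction form an antipodal pair, e.g. \<open>z 1 = z 2 = z 3\<close> for direction 0 and
  \<open>z 0 = z 1 \<noteq> z 2\<close> for direction 3.\<close>

definition match_dir :: "(nat \<Rightarrow> bool) \<Rightarrow> nat" where
  "match_dir z = (if z 1 = z 2 \<and> z 2 = z 3 then 0 else if z 0 = z 1 \<and> z 1 \<noteq> z 2 then 3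
     else if z 0 = z 3 \<and> z 3 \<noteq> z 1 then 2 else 1)"

lemma match_dir_less: "match_dir z < 4"
  by (simp add: match_dir_def)

text \<open>Moving along the chosen direction does not alter the choice, so \<open>match_dir\<close>
  really defines a matching.\<close>

lemma match_dir_invariant:
  assumes "\<And>s. s < 4 \<Longrightarrow> s \<noteq> match_dir z \<Longrightarrow> z' s = z s"
  shows "match_dir z' = match_dir z"
  using assms[of 0] assms[of 1] assms[of 2] assms[of 3]
  by (cases "z 0"; cases "z 1"; cases "z 2"; cases "z 3"; simp add: match_dir_def)

lemma less_4_cases: "(s::nat) < 4 \<Longrightarrow> s = 0 \<or> s = 1 \<or> s = 2 \<or> s = 3"
  by auto

lemma all_less_4: "(\<forall>s<4. P (s::nat)) \<longleftrightarrow> P 0 \<and> P 1 \<and> P 2 \<and> P 3"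
  using less_4_cases by fastforce

lemma ex_less_4: "(\<exists>s<4. P (s::nat)) \<longleftrightarrow> P 0 \<or> P 1 \<or> P 2 \<or> P 3"
  using all_less_4[of "\<lambda>s. \<not> P s"] by blast

definition vec4 :: "bool \<Rightarrow> bool \<Rightarrow> bool \<Rightarrow> bool \<Rightarrow> nat \<Rightarrow> bool" where
  "vec4 p q r t s = (if s = 0 then p else if s = 1 then q else if s = 2 then r else t)"

text \<open>Reduces the search for a function to four Boolean values, which \<open>simp\<close> can
  enumerate.\<close>

lemma ex_vec4:
  assumes "\<exists>p q r t. P (vec4 p q r t)"
  shows "\<exists>w. P w"
  using assms by blast

text \<open>Serves the case of at most one prescribed row parity: any other row can be made the
  matched one.\<close>

lemma match_dir_facet:
  assumes "r < 4" "u < 4" "r \<noteq> u"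
  shows "\<exists>w. match_dir w = r \<and> w u = a"
  by (rule ex_vec4)
    (use less_4_cases[OF assms(1)] less_4_cases[OF assms(2)] assms(3) in
      \<open>elim disjE; simp add: match_dir_def vec4_def ex_bool_eq; cases a; simp\<close>)

text \<open>Serves the case of two prescribed row parities. Which of \<open>s\<close> and
  \<open>t\<close> is matched depends on \<open>c\<close>, so both rows must then be usable.\<close>

lemma match_dir_square:
  assumes "s < 4" "t < 4" "s \<noteq> t"
  shows "\<exists>w. match_dir w \<in> {s, t} \<and> (\<forall>u<4. u \<noteq> s \<longrightarrow> u \<noteq> t \<longrightarrow> w u = c u)"
  by (rule ex_vec4)
    (use less_4_cases[OF assms(1)] less_4_cases[OF assms(2)] assms(3) in
      \<open>elim disjE; simp add: match_dir_def vec4_def ex_bool_eq all_less_4;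
        cases "c 0"; cases "c 1"; cases "c 2"; cases "c 3"; simp\<close>)

section \<open>Choosing the row to move in\<close>

lemma sum_less_4: "(\<Sum>s<(4::nat). m s) = m 0 + m 1 + m 2 + (m 3 :: nat)"
  by (simp add: numeral_eq_Suc)

text \<open>Here \<open>m s\<close> stands for the number of free cells in row \<open>s\<close> and
  \<open>c\<close> for the current row parities, which rows without free cells must keep.\<close>

lemma steering_direction:
  fixes m :: "nat \<Rightarrow> nat"
  assumes "k > 0" and le: "\<And>s. s < 4 \<Longrightarrow> m s \<le> n"
    and sum1: "4 * k - 3 \<le> (\<Sum>s<4. m s)" and sum2: "n + k \<le> (\<Sum>s<4. m s)"
  shows "\<exists>w. k \<le> m (match_dir w) \<and> (\<forall>s<4. m s = 0 \<longrightarrow> w s = c s)"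
proof -
  \<comment> \<open>Otherwise the sum would be at most \<open>4 * (k - 1)\<close>, one less than
    \<open>4 * k - 3\<close>.\<close>
  have "\<exists>r<4. k \<le> m r"
  proof (rule ccontr)
    assume "\<not> ?thesis"
    then have "m 0 < k" "m 1 < k" "m 2 < k" "m 3 < k" by (auto simp: not_le)
    then show False using sum1 unfolding sum_less_4 by linarith
  qed
  then obtain r where r: "r < 4" "k \<le> m r" by blast
  show ?thesis
  \<comment> \<open>The first case says that at most one row \<open>u\<close> is rigid;
    \<open>r\<close> itself has free cells because \<open>k > 0\<close>.\<close>
  proof (cases "\<exists>u<4. u \<noteq> r \<and> (\<forall>s<4. s \<noteq> r \<longrightarrow> s \<noteq> u \<longrightarrow> m s > 0)")
    case True
    then obtain u where u: "u < 4" "u \<noteq> r" "\<forall>s<4. s \<noteq> r \<longrightarrow> s \<noteq> u \<longrightarrow> m s > 0" by blast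
    obtain w where "match_dir w = r" "w u = c u"
      using match_dir_facet[of r u "c u"] r u by auto
    then show ?thesis using r u \<open>k > 0\<close> by (metis not_gr_zero not_le)
  next
    case False
    \<comment> \<open>At least two of the three rows other than \<open>r\<close> are now rigid;
      \<open>t\<close> is the remaining one.\<close>
    have "\<exists>t<4. t \<noteq> r \<and> (\<forall>s<4. s \<noteq> r \<longrightarrow> s \<noteq> t \<longrightarrow> m s = 0)"
      using False less_4_cases[OF r(1)] unfolding ex_less_4 all_less_4
      by (elim disjE; simp; blast)
    then obtain t where t: "t < 4" "t \<noteq> r" "\<forall>s<4. s \<noteq> r \<longrightarrow> s \<noteq> t \<longrightarrow> m s = 0" by blast
    have "(\<Sum>s<4. m s) = (\<Sum>s\<in>{r, t}. m s)"
      by (rule sum.mono_neutral_right) (use r t in auto)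
    then have "n + k \<le> m r + m t" using sum2 t by simp
    \<comment> \<open>Row \<open>r\<close> holds at most \<open>n\<close> of the
      \<open>n + k\<close> free cells.\<close>
    then have "k \<le> m t" using le[OF r(1)] by linarith
    obtain w where "match_dir w \<in> {r, t}" "\<forall>u<4. u \<noteq> r \<longrightarrow> u \<noteq> t \<longrightarrow> w u = c u"
      using match_dir_square[of r t c] r t by auto
    then show ?thesis using r \<open>k \<le> m t\<close> \<open>k > 0\<close>
      by (metis (no_types) insertE not_gr_zero not_le singletonD)
  qed
qed

section \<open>Row and column parities of the grid\<close>

text \<open>The cell in row \<open>r\<close> and column \<open>j\<close> is the coordinate \<open>4 * j + r\<close>.\<close>

definition col_parity :: "nat \<Rightarrow> bool list \<Rightarrow> bool list" where
  "col_parity n x =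
     map (\<lambda>j. odd (card {s. s < 4 \<and> x ! (4 * j + s)})) [0..<n]"

definition row_parity :: "nat \<Rightarrow> bool list \<Rightarrow> nat \<Rightarrow> bool" where
  "row_parity n x s \<longleftrightarrow> odd (card {j. j < n \<and> x ! (4 * j + s)})"

lemma length_col_parity [simp]: "length (col_parity n x) = n"
  by (simp add: col_parity_def)

lemma nth_col_parity:
  "j < n \<Longrightarrow> col_parity n x ! j \<longleftrightarrow> odd (card {s. s < 4 \<and> x ! (4 * j + s)})"
  by (simp add: col_parity_def)

lemma cell_less: "j < n \<Longrightarrow> s < 4 \<Longrightarrow> 4 * j + s < 4 * (n::nat)"
  by simp

lemma cell_eq_iff:
  fixes i j r s :: nat
  assumes "r < 4" "s < 4"
  shows "4 * j + r = 4 * i + s \<longleftrightarrow> j = i \<and> r = s"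
  using assms by presburger

lemma col_parity_flip:
  assumes "length x = 4 * n" "j < n" "r < 4"
  shows "col_parity n (flip (4 * j + r) x) = flip j (col_parity n x)"
proof (rule nth_equalityI)
  fix l assume "l < length (col_parity n (flip (4 * j + r) x))"
  then have l: "l < n" by simp
  have "{s. s < 4 \<and> flip (4 * j + r) x ! (4 * l + s)} =
     {s. s < 4 \<and> (if l = j \<and> s = r then \<not> x ! (4 * l + s) else x ! (4 * l + s))}"
    using assms l by (auto simp: nth_flip cell_eq_iff)
  then show "col_parity n (flip (4 * j + r) x) ! l = flip j (col_parity n x) ! l"
    using assms l odd_card_flip[of r 4 "\<lambda>s. x ! (4 * l + s)"]
    by (cases "l = j") (simp_all add: nth_col_parity nth_flip)
qed simp

lemma row_parity_flip_other:
  assumes "length x = 4 * n" "j < n" "r < 4" "s < 4" "s \<noteq> r"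
  shows "row_parity n (flip (4 * j + r) x) s = row_parity n x s"
proof -
  have "flip (4 * j + r) x ! (4 * l + s) = x ! (4 * l + s)" for l
    using assms cell_eq_iff[of s r l j] by (simp add: nth_flip)
  then show ?thesis by (simp add: row_parity_def)
qed

section \<open>The pairing of the large cube\<close>

definition product_pairing :: "nat \<Rightarrow> bool list set set \<Rightarrow> bool list set set" where
  "product_pairing n M = {{x, flip (4 * j + match_dir (row_parity n x)) x} |x j.
     length x = 4 * n \<and> j < n \<and> {col_parity n x, flip j (col_parity n x)} \<in> M}"

lemma match_dir_row_parity_flip:
  assumes "length x = 4 * n" "j < n"
  shows "match_dir (row_parity n (flip (4 * j + match_dir (row_parity n x)) x)) =
    match_dir (row_parity n x)"
  by (rule match_dir_invariant) (use assms row_parity_flip_other match_dir_less in blast)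

text \<open>Either endpoint can serve as base point: flipping the cell keeps the matched row and
  swaps the ends of the edge of \<open>M\<close>.\<close>

lemma product_pairing_at:
  assumes "e \<in> product_pairing n M" "y \<in> e"
  obtains j where "length y = 4 * n" "j < n" "{col_parity n y, flip j (col_parity n y)} \<in> M"
    "e = {y, flip (4 * j + match_dir (row_parity n y)) y}"
proof -
  obtain x j where x: "length x = 4 * n" "j < n" "{col_parity n x, flip j (col_parity n x)} \<in> M"
    and e: "e = {x, flip (4 * j + match_dir (row_parity n x)) x}"
    using assms(1) by (auto simp: product_pairing_def)
  let ?y = "flip (4 * j + match_dir (row_parity n x)) x"
  have y: "match_dir (row_parity n ?y) = match_dir (row_parity n x)"
    "col_parity n ?y = flip j (col_parity n x)"
    using x match_dir_row_parity_flip col_parity_flip match_dir_less by blast+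
  consider "y = x" | "y = ?y" using assms(2) e by blast
  then show thesis
  proof cases
    case 1
    then show ?thesis using x e that by blast
  next
    case 2
    show ?thesis
      by (rule that[of j]) (use x e y 2 in \<open>simp_all add: insert_commute\<close>)
  qed
qed

text \<open>Two pairs meeting at \<open>y\<close> flip cells of the same row, and their columns come
  from edges of \<open>M\<close> through \<open>col_parity n y\<close>, of which there is only
  one.\<close>

lemma cube_matching_product_pairing:
  assumes "cube_matching n M"
  shows "cube_matching (4 * n) (product_pairing n M)"
  unfolding cube_matching_def
proof
  show "product_pairing n M \<subseteq> cube_edges (4 * n)"
  proof
    fix e assume "e \<in> product_pairing n M"
    then obtain x j where "length x = 4 * n" "j < n"
      "e = {x, flip (4 * j + match_dir (row_parity n x)) x}"
      by (auto simp: product_pairing_def)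
    then show "e \<in> cube_edges (4 * n)"
      unfolding cube_edges_flip mem_Collect_eq
      by (intro exI[of _ x] exI[of _ "4 * j + match_dir (row_parity n x)"])
        (simp add: cell_less match_dir_less)
  qed
  show "pairwise disjnt (product_pairing n M)"
  proof (rule pairwiseI, rule ccontr)
    fix e e' assume e: "e \<in> product_pairing n M" "e' \<in> product_pairing n M" "e \<noteq> e'" "\<not> disjnt e e'"
    then obtain y where y: "y \<in> e" "y \<in> e'" by (auto simp: disjnt_def)
    obtain j where j: "length y = 4 * n" "j < n" "{col_parity n y, flip j (col_parity n y)} \<in> M"
      "e = {y, flip (4 * j + match_dir (row_parity n y)) y}"
      by (rule product_pairing_at[OF e(1) y(1)])
    obtain j' where j': "length y = 4 * n" "j' < n" "{col_parity n y, flip j' (col_parity n y)} \<in> M"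
      "e' = {y, flip (4 * j' + match_dir (row_parity n y)) y}"
      by (rule product_pairing_at[OF e(2) y(2)])
    have "{col_parity n y, flip j (col_parity n y)} = {col_parity n y, flip j' (col_parity n y)}"
    proof (rule ccontr)
      assume "\<not> ?thesis"
      then have "disjnt {col_parity n y, flip j (col_parity n y)} {col_parity n y, flip j' (col_parity n y)}"
        using assms j(3) j'(3) unfolding cube_matching_def by (meson pairwiseD)
      then show False by simp
    qed
    then have "flip j (col_parity n y) = flip j' (col_parity n y)"
      by (metis doubleton_eq_iff)
    then have "j = j'" using j(2) j'(2) by (simp add: flip_eq_iff)
    then show False using j(4) j'(4) e(3) by simp
  qed
qed

section \<open>Adjusting parities inside a subcube\<close>

text \<open>One free cell is flipped in each row of wrong parity; distinct rows do not
  interfere.\<close>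

lemma row_parity_steer:
  assumes free: "\<And>s. s < 4 \<Longrightarrow> {j. j < n \<and> 4 * j + s \<notin> F} \<noteq> {} \<or> row_parity n x s = w s"
    and len: "length x = 4 * n"
  obtains y where "length y = 4 * n" "\<And>i. i < 4 * n \<Longrightarrow> i \<in> F \<Longrightarrow> y ! i = x ! i"
    "\<And>s. s < 4 \<Longrightarrow> row_parity n y s = w s"
proof -
  \<comment> \<open>The choice is meaningful only if row \<open>s\<close> has a free cell;
    \<open>ch\<close> consults it only for rows of wrong parity, where \<open>free\<close> supplies
    one.\<close>
  define col where "col s = (SOME j. j < n \<and> 4 * j + s \<notin> F)" for s
  define ch where "ch i \<longleftrightarrow> row_parity n x (i mod 4) \<noteq> w (i mod 4) \<and> i div 4 = col (i mod 4)" for i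
  define y where "y = map (\<lambda>i. if ch i then \<not> x ! i else x ! i) [0..<4 * n]"
  have col: "col s < n \<and> 4 * col s + s \<notin> F" if "s < 4" "row_parity n x s \<noteq> w s" for s
    unfolding col_def by (rule someI_ex) (use free[OF that(1)] that(2) in blast)
  show thesis
  proof
    show "length y = 4 * n" by (simp add: y_def)
    fix i assume "i < 4 * n" "i \<in> F"
    moreover have "\<not> ch i"
    proof
      assume "ch i"
      then have "4 * (i div 4) + i mod 4 \<notin> F" using col[of "i mod 4"] by (simp add: ch_def)
      then show False using \<open>i \<in> F\<close> by simp
    qed
    ultimately show "y ! i = x ! i" by (simp add: y_def)
  next
    fix s :: nat assume s: "s < 4"
    have nth: "y ! (4 * j + s) = (if row_parity n x s \<noteq> w s \<and> j = col s
        then \<not> x ! (4 * j + s) else x ! (4 * j + s))" if "j < n" for j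
      using that s by (simp add: y_def ch_def)
    show "row_parity n y s = w s"
    proof (cases "row_parity n x s = w s")
      case True
      then have "{j. j < n \<and> y ! (4 * j + s)} = {j. j < n \<and> x ! (4 * j + s)}"
        by (intro Collect_cong conj_cong refl) (simp add: nth)
      then show ?thesis using True by (simp add: row_parity_def)
    next
      case False
      then have "{j. j < n \<and> y ! (4 * j + s)} =
        {j. j < n \<and> (if j = col s then \<not> x ! (4 * j + s) else x ! (4 * j + s))}"
        by (intro Collect_cong conj_cong refl) (simp add: nth)
      then show ?thesis
        using False odd_card_flip[of "col s" n "\<lambda>j. x ! (4 * j + s)"] col[OF s False]
        by (simp add: row_parity_def)
    qed
  qed
qed

text \<open>In each column of wrong parity the cell in row \<open>r\<close> is flipped, so only the
  parity of row \<open>r\<close> can change along the way.\<close>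

lemma col_parity_steer:
  assumes "length x = 4 * n" "r < 4" and a: "length a = n"
    and fixed: "\<And>j. j < n \<Longrightarrow> 4 * j + r \<in> F \<Longrightarrow> a ! j = col_parity n x ! j"
  obtains y where "length y = 4 * n" "\<And>i. i < 4 * n \<Longrightarrow> i \<in> F \<Longrightarrow> y ! i = x ! i"
    "\<And>s. s < 4 \<Longrightarrow> s \<noteq> r \<Longrightarrow> row_parity n y s = row_parity n x s" "col_parity n y = a"
proof -
  define ch where "ch i \<longleftrightarrow> i mod 4 = r \<and> a ! (i div 4) \<noteq> col_parity n x ! (i div 4)" for i
  define y where "y = map (\<lambda>i. if ch i then \<not> x ! i else x ! i) [0..<4 * n]"
  have nth: "y ! (4 * j + s) = (if s = r \<and> a ! j \<noteq> col_parity n x ! j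
      then \<not> x ! (4 * j + s) else x ! (4 * j + s))" if "j < n" "s < 4" for j s
    using that by (simp add: y_def ch_def)
  show thesis
  proof
    show "length y = 4 * n" by (simp add: y_def)
    fix i assume "i < 4 * n" "i \<in> F"
    moreover have "\<not> ch i"
    proof
      assume "ch i"
      moreover have "4 * (i div 4) + i mod 4 = i" by simp
      ultimately have "4 * (i div 4) + r \<in> F" using \<open>i \<in> F\<close> by (simp add: ch_def)
      then show False using fixed[of "i div 4"] \<open>ch i\<close> \<open>i < 4 * n\<close> by (auto simp: ch_def)
    qed
    ultimately show "y ! i = x ! i" by (simp add: y_def)
  next
    fix s assume s: "s < 4" "s \<noteq> r"
    then have "{j. j < n \<and> y ! (4 * j + s)} = {j. j < n \<and> x ! (4 * j + s)}"
      by (intro Collect_cong conj_cong refl) (simp add: nth)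
    then show "row_parity n y s = row_parity n x s" by (simp add: row_parity_def)
  next
    show "col_parity n y = a"
    proof (rule nth_equalityI)
      fix j assume "j < length (col_parity n y)"
      then have j: "j < n" by simp
      show "col_parity n y ! j = a ! j"
      proof (cases "a ! j = col_parity n x ! j")
        case True
        then have "{s. s < 4 \<and> y ! (4 * j + s)} = {s. s < 4 \<and> x ! (4 * j + s)}"
          by (intro Collect_cong conj_cong refl) (simp add: nth j)
        then show ?thesis using True j by (simp add: nth_col_parity)
      next
        case False
        then have "{s. s < 4 \<and> y ! (4 * j + s)} =
          {s. s < 4 \<and> (if s = r then \<not> x ! (4 * j + s) else x ! (4 * j + s))}"
          by (intro Collect_cong conj_cong refl) (simp add: nth j)
        then show ?thesis
          using False odd_card_flip[of r 4 "\<lambda>s. x ! (4 * j + s)"] j \<open>r < 4\<close>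
          by (simp add: nth_col_parity)
      qed
    qed (simp add: a)
  qed
qed

section \<open>Every large subcube contains a pair\<close>

lemma card_rows:
  fixes n :: nat
  assumes "A \<subseteq> {..<4 * n}"
  shows "card A = (\<Sum>s<4. card {j. j < n \<and> 4 * j + s \<in> A})"
proof -
  have "A = (\<Union>s\<in>{..<4}. (\<lambda>j. 4 * j + s) ` {j. j < n \<and> 4 * j + s \<in> A})"
  proof (intro equalityI subsetI)
    fix i assume i: "i \<in> A"
    then have "i div 4 < n" "i mod 4 < 4" "i = 4 * (i div 4) + i mod 4" using assms by auto
    then show "i \<in> (\<Union>s\<in>{..<4}. (\<lambda>j. 4 * j + s) ` {j. j < n \<and> 4 * j + s \<in> A})"
      using i by (intro UN_I[of "i mod 4"] image_eqI[of _ _ "i div 4"]) auto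
  qed auto
  then have "card A = card (\<Union>s\<in>{..<4}. (\<lambda>j. 4 * j + s) ` {j. j < n \<and> 4 * j + s \<in> A})"
    by simp
  also have "\<dots> = (\<Sum>s<4. card ((\<lambda>j. 4 * j + s) ` {j. j < n \<and> 4 * j + s \<in> A}))"
    by (rule card_UN_disjoint) (auto simp: cell_eq_iff)
  also have "\<dots> = (\<Sum>s<4. card {j. j < n \<and> 4 * j + s \<in> A})"
    by (intro sum.cong refl card_image) (simp add: inj_on_def)
  finally show ?thesis .
qed

lemma breaker_pairing_product:
  assumes k: "k > 0" and M: "breaker_pairing_strategy n k M"
    and b: "4 * k - 3 \<le> b" "n + k \<le> b"
  shows "breaker_pairing_strategy (4 * n) b (product_pairing n M)"
  unfolding breaker_pairing_strategy_def
proof (intro conjI ballI)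
  have matching: "cube_matching n M"
    and hit: "\<And>S. S \<in> subcubes n k \<Longrightarrow> \<exists>e\<in>M. e \<subseteq> S"
    using M by (auto simp: breaker_pairing_strategy_def)
  show "cube_matching (4 * n) (product_pairing n M)"
    by (rule cube_matching_product_pairing[OF matching])
  fix S assume "S \<in> subcubes (4 * n) b"
  then obtain F c where S: "S = {x \<in> cube_verts (4 * n). \<forall>i\<in>F. x ! i = c i}"
    and F: "F \<subseteq> {..<4 * n}" "card F + b = 4 * n"
    by (auto simp: subcubes_def)
  define J where "J s = {j. j < n \<and> 4 * j + s \<notin> F}" for s
  \<comment> \<open>A starting point in \<open>S\<close>; on the free coordinates \<open>c\<close>
    is just a default.\<close>
  define x0 where "x0 = map c [0..<4 * n]"
  have x0: "length x0 = 4 * n" "\<And>i. i < 4 * n \<Longrightarrow> x0 ! i = c i"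
    by (auto simp: x0_def)
  have fin: "finite (J s)" for s by (simp add: J_def)
  have "card ({..<4 * n} - F) = 4 * n - card F"
    using F by (subst card_Diff_subset) (auto intro: finite_subset)
  then have "b = card ({..<4 * n} - F)" using F by simp
  also have "\<dots> = (\<Sum>s<4. card {j. j < n \<and> 4 * j + s \<in> {..<4 * n} - F})"
    by (rule card_rows) simp
  also have "\<dots> = (\<Sum>s<4. card (J s))"
    by (intro sum.cong refl arg_cong[of _ _ card]) (auto simp: J_def)
  finally have sum: "b = (\<Sum>s<4. card (J s))" .
  have "card (J s) \<le> card {..<n}" for s
    by (rule card_mono) (auto simp: J_def)
  then have "\<exists>w. k \<le> card (J (match_dir w)) \<and> (\<forall>s<4. card (J s) = 0 \<longrightarrow> w s = row_parity n x0 s)"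
    using steering_direction[of k "\<lambda>s. card (J s)" n] k b sum by simp
  then obtain w where w: "k \<le> card (J (match_dir w))"
    "\<And>s. s < 4 \<Longrightarrow> J s = {} \<Longrightarrow> w s = row_parity n x0 s"
    by auto
  define r where "r = match_dir w"
  have r: "r < 4" by (simp add: r_def match_dir_less)
  obtain x1 where x1: "length x1 = 4 * n" "\<And>i. i < 4 * n \<Longrightarrow> i \<in> F \<Longrightarrow> x1 ! i = x0 ! i"
    "\<And>s. s < 4 \<Longrightarrow> row_parity n x1 s = w s"
    by (rule row_parity_steer[of n F x0 w]) (use w(2) x0(1) in \<open>auto simp: J_def\<close>)
  obtain K where K: "K \<subseteq> J r" "card K = k"
    using w(1) obtain_subset_with_card_n unfolding r_def by blast
  have Kn: "K \<subseteq> {..<n}" using K by (auto simp: J_def)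
  \<comment> \<open>The column parities reachable from \<open>x1\<close> by flipping cells of row
    \<open>r\<close> in the columns of \<open>K\<close>, all of them free.\<close>
  define T where "T = {u \<in> cube_verts n. \<forall>j\<in>{..<n} - K. u ! j = col_parity n x1 ! j}"
  have "card ({..<n} - K) + k = n"
    using Kn K card_mono[OF _ Kn] by (subst card_Diff_subset) (auto intro: finite_subset)
  then have "T \<in> subcubes n k"
    unfolding subcubes_def T_def by blast
  then obtain e where e: "e \<in> M" "e \<subseteq> T" using hit by blast
  then have "e \<in> cube_edges n" using matching by (auto simp: cube_matching_def)
  then obtain a j where a: "e = {a, flip j a}" "length a = n" "j < n"
    by (auto simp: cube_edges_flip)
  have "a \<in> T" "flip j a \<in> T" using a e by auto
  then have aT: "\<And>l. l < n \<Longrightarrow> l \<notin> K \<Longrightarrow> a ! l = col_parity n x1 ! l"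
    and "\<And>l. l < n \<Longrightarrow> l \<notin> K \<Longrightarrow> flip j a ! l = col_parity n x1 ! l"
    by (auto simp: T_def)
  \<comment> \<open>The ends of \<open>e\<close> differ at \<open>j\<close>, while points of
    \<open>T\<close> agree outside \<open>K\<close>.\<close>
  then have "j \<in> K" using a nth_flip[of j a j] by metis
  then have cell: "4 * j + r \<notin> F" using K by (auto simp: J_def)
  obtain x where x: "length x = 4 * n" "\<And>i. i < 4 * n \<Longrightarrow> i \<in> F \<Longrightarrow> x ! i = x1 ! i"
    "\<And>s. s < 4 \<Longrightarrow> s \<noteq> r \<Longrightarrow> row_parity n x s = row_parity n x1 s" "col_parity n x = a"
  proof (rule col_parity_steer[of x1 n r a F])
    fix l assume "l < n" "4 * l + r \<in> F"
    then have "l \<notin> K" using K by (auto simp: J_def)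
    then show "a ! l = col_parity n x1 ! l" using aT \<open>l < n\<close> by blast
  qed (use x1 r a in auto)
  \<comment> \<open>From \<open>x1\<close> to \<open>x\<close> only the parity of row
    \<open>r\<close> may have changed, and \<open>r\<close> is the matched direction at
    \<open>w\<close>.\<close>
  have dir: "match_dir (row_parity n x) = r"
    unfolding r_def by (rule match_dir_invariant) (use x x1 r_def in auto)
  have "{col_parity n x, flip j (col_parity n x)} \<in> M"
    using x(4) a(1) e(1) by simp
  then have pair: "{x, flip (4 * j + r) x} \<in> product_pairing n M"
    unfolding product_pairing_def dir[symmetric] using x(1) a(3) by blast
  have xF: "x ! i = c i" if "i \<in> F" for i
    using that F(1) x(2) x1(2) x0(2) by (metis lessThan_iff subsetD)
  then have "x \<in> S" using x(1) by (simp add: S cube_verts_def)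
  have "flip (4 * j + r) x ! i = c i" if "i \<in> F" for i
    using that xF cell nth_flip[of "4 * j + r" x i] x(1) cell_less[OF a(3) r] by auto
  then have "flip (4 * j + r) x \<in> S" using x(1) by (simp add: S cube_verts_def)
  with pair \<open>x \<in> S\<close> show "\<exists>e\<in>product_pairing n M. e \<subseteq> S"
    by (intro bexI[of _ "{x, flip (4 * j + r) x}"]) simp_all
qed

theorem theorem2:
  fixes n k :: nat
  assumes "n > 0" and "k > 0"
    and "\<exists>M. breaker_pairing_strategy n k M"
  shows "\<exists>M. breaker_pairing_strategy (4 * n) (max (4 * k - 3) (n + k)) M"
  using assms(2,3) breaker_pairing_product[OF _ _ max.cobounded1 max.cobounded2] by blast

end
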